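(* Let $X$ be a non-empty set, $(S,\cdot,0)$ a commutative semigroup with zero, and $f$ a function from $X$ to $S$. Suppose that the graph $\Gamma_{(S,f)}(X)$ has at least three vertices and that for all $x,y\in X$, if $f(x)f(y)\neq 0$ then there exists a $z\in X$ such that $f(z)=f(x)f(y)$. If $\Gamma_{(S,f)}(X)$ contains a cycle, then the core $K$ of $\Gamma_{(S,f)}(X)$ is a union of triangles and rectangles.
   Context: A commutative semigroup with zero $(S,\cdot,0)$ is a commutative multiplicative semigroup with an element $0$ satisfying $0\cdot s=0$ for all $s\in S$. Given a non-empty set $X$ and a function $f:X\to S$, the simple graph $\Gamma_{(S,f)}(X)$ is defined as follows. An element $x\in X$ is a vertex if $f(x)\neq 0$ and there is a $y\in X$ with $y\neq x$, $f(y)\neq 0$ and $f(x)\cdot f(y)=0$. For $x,y\in X$, $\{x,y\}$ is an edge if $x\neq y$, $f(x)\neq 0$, $f(y)\neq 0$ and $f(x)\cdot f(y)=0$. A cycle is a closed path $x_0-x_1-\cdots-x_{k-1}-x_0$ with $k\geq 3$ and $x_0,\dots,x_{k-1}$ distinct; $k$ is its length. A triangle is a cycle of length $3$ and a rectangle is a cycle of length $4$ (as subgraphs, not necessarily induced). The core of a graph $\Gamma$ is the largest subgraph of $\Gamma$ in which every edge is the edge of a cycle in $\Gamma$, i.e. the subgraph consisting of all edges of $\Gamma$ lying on some cycle of $\Gamma$, together with their endpoints. *)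

theory Defs
  imports Main
begin

record 'a sgraph =
  verts :: "'a set"
  edges :: "'a set set"

definition subgraph :: "'a sgraph \<Rightarrow> 'a sgraph \<Rightarrow> bool" where
  "subgraph H G \<longleftrightarrow> verts H \<subseteq> verts G \<and> edges H \<subseteq> edges G"

definition graph_Union :: "'a sgraph set \<Rightarrow> 'a sgraph" where
  "graph_Union \<C> = \<lparr>verts = (\<Union>H\<in>\<C>. verts H), edges = (\<Union>H\<in>\<C>. edges H)\<rparr>"

text \<open>The graph x_0 - x_1 - ... - x_{k-1} - x_0, where xs = [x_0, ..., x_{k-1}].\<close>

definition closed_path_graph :: "'a list \<Rightarrow> 'a sgraph" where
  "closed_path_graph xs =
    \<lparr>verts = set xs,
     edges = {{xs ! i, xs ! ((i + 1) mod length xs)} | i. i < length xs}\<rparr>"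

definition cycle_of_length :: "nat \<Rightarrow> 'a sgraph \<Rightarrow> bool" where
  "cycle_of_length k C \<longleftrightarrow>
    k \<ge> 3 \<and> (\<exists>xs. length xs = k \<and> distinct xs \<and> C = closed_path_graph xs)"

definition is_cycle :: "'a sgraph \<Rightarrow> bool" where
  "is_cycle C \<longleftrightarrow> (\<exists>k. cycle_of_length k C)"

definition triangle :: "'a sgraph \<Rightarrow> bool" where
  "triangle C \<longleftrightarrow> cycle_of_length 3 C"

definition rectangle :: "'a sgraph \<Rightarrow> bool" where
  "rectangle C \<longleftrightarrow> cycle_of_length 4 C"

definition core_edges :: "'a sgraph \<Rightarrow> 'a set set" where
  "core_edges G = {e \<in> edges G. \<exists>C. is_cycle C \<and> subgraph C G \<and> e \<in> edges C}"

definition core :: "'a sgraph \<Rightarrow> 'a sgraph" where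
  "core G = \<lparr>verts = \<Union>(core_edges G), edges = core_edges G\<rparr>"

text \<open>
  The sort {ab_semigroup_mult, mult_zero} is that of commutative semigroups with zero.
  The map f is total on the type of X, but only its values on X matter.
\<close>

definition zd_graph :: "'x set \<Rightarrow> ('x \<Rightarrow> 's::{ab_semigroup_mult, mult_zero}) \<Rightarrow> 'x sgraph" where
  "zd_graph X f =
    \<lparr>verts = {x \<in> X. f x \<noteq> 0 \<and> (\<exists>y\<in>X. y \<noteq> x \<and> f y \<noteq> 0 \<and> f x * f y = 0)},
     edges = {{x, y} | x y. x \<in> X \<and> y \<in> X \<and> x \<noteq> y \<and> f x \<noteq> 0 \<and> f y \<noteq> 0 \<and> f x * f y = 0}\<rparr>"

end

theory Submission
  imports Defs
begin

text \<open>
  It suffices to put every edge \<open>x - y\<close> that lies on a cycle of length at least four onto a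
  triangle or a rectangle. Follow the cycle two steps away from the edge on either side, which
  gives a walk \<open>d - a - x - y - b - c\<close>. If \<open>f a * f b = 0\<close>, then \<open>a, x, y, b\<close> form a rectangle.
  Otherwise some \<open>z\<close> in \<open>X\<close> has \<open>f z = f a * f b\<close>, and \<open>f z\<close> annihilates \<open>f x\<close> (through \<open>f a\<close>)
  and \<open>f y\<close> (through \<open>f b\<close>). So \<open>x, y, z\<close> form a triangle unless \<open>z\<close> is \<open>x\<close> or \<open>y\<close>. If \<open>z = x\<close>,
  then \<open>f x\<close> is a multiple of \<open>f b\<close> and hence annihilates \<open>f c\<close>, so \<open>x, y, b, c\<close> form a rectangle;
  if \<open>z = y\<close>, then symmetrically \<open>d, a, x, y\<close> form one. This is the lemma
  \<open>walk_middle_edge_in_short_cycle\<close>; the lemma \<open>cycle_edge_walk\<close> provides the walk.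
\<close>

lemma verts_closed_path_graph:
  "verts (closed_path_graph xs) = \<Union> (edges (closed_path_graph xs))"
proof
  show "verts (closed_path_graph xs) \<subseteq> \<Union> (edges (closed_path_graph xs))"
  proof
    fix x assume "x \<in> verts (closed_path_graph xs)"
    then obtain i where "i < length xs" "x = xs ! i"
      by (auto simp: closed_path_graph_def in_set_conv_nth)
    then have "{x, xs ! ((i + 1) mod length xs)} \<in> edges (closed_path_graph xs)"
      by (auto simp: closed_path_graph_def)
    then show "x \<in> \<Union> (edges (closed_path_graph xs))" by blast
  qed
  show "\<Union> (edges (closed_path_graph xs)) \<subseteq> verts (closed_path_graph xs)"
  proof -
    have "xs ! i \<in> set xs" "xs ! ((i + 1) mod length xs) \<in> set xs" if "i < length xs" for i
    proof -
      from that have "(i + 1) mod length xs < length xs"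
        by (intro mod_less_divisor) linarith
      with that show "xs ! i \<in> set xs" "xs ! ((i + 1) mod length xs) \<in> set xs"
        by (blast intro: nth_mem)+
    qed
    then show ?thesis by (auto simp: closed_path_graph_def)
  qed
qed

lemma verts_cycle:
  assumes "is_cycle C"
  shows "verts C = \<Union> (edges C)"
  using assms unfolding is_cycle_def cycle_of_length_def by (metis verts_closed_path_graph)

lemma triangle_or_rectangle_is_cycle:
  "triangle C \<or> rectangle C \<Longrightarrow> is_cycle C"
  by (auto simp: is_cycle_def triangle_def rectangle_def)

text \<open>
  A cycle has no isolated vertices, so a union of cycles is determined by its edges, as the core is.
\<close>

lemma core_eq_graph_Union:
  assumes "\<And>e. e \<in> core_edges G \<Longrightarrow>
    \<exists>C. (triangle C \<or> rectangle C) \<and> subgraph C G \<and> e \<in> edges C"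
  shows "core G = graph_Union {C. (triangle C \<or> rectangle C) \<and> subgraph C G}"
proof -
  let ?F = "{C. (triangle C \<or> rectangle C) \<and> subgraph C G}"
  have E: "core_edges G = (\<Union>C\<in>?F. edges C)"
  proof
    show "core_edges G \<subseteq> (\<Union>C\<in>?F. edges C)"
      using assms by fast
    show "(\<Union>C\<in>?F. edges C) \<subseteq> core_edges G"
      using triangle_or_rectangle_is_cycle by (fastforce simp: core_edges_def subgraph_def)
  qed
  have "(\<Union>C\<in>?F. verts C) = (\<Union>C\<in>?F. \<Union> (edges C))"
    using verts_cycle triangle_or_rectangle_is_cycle by (intro SUP_cong) auto
  then have "\<Union> (core_edges G) = (\<Union>C\<in>?F. verts C)"
    unfolding E by auto
  with E show ?thesis
    by (simp add: core_def graph_Union_def)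
qed

lemma edges_closed_path_graph_eq_image:
  "edges (closed_path_graph xs) =
    (\<lambda>i. {xs ! i, xs ! (Suc i mod length xs)}) ` {..<length xs}"
  by (auto simp: closed_path_graph_def)

lemma edges_closed_path_graph_3:
  "edges (closed_path_graph [x, y, z]) = {{x, y}, {y, z}, {z, x}}"
  by (auto simp: edges_closed_path_graph_eq_image lessThan_Suc)

lemma edges_closed_path_graph_4:
  "edges (closed_path_graph [w, x, y, z]) = {{w, x}, {x, y}, {y, z}, {z, w}}"
  by (auto simp: edges_closed_path_graph_eq_image lessThan_Suc)

lemma triangleI:
  assumes "\<Union> (edges G) \<subseteq> verts G" and "distinct [x, y, z]"
    and "{x, y} \<in> edges G" "{y, z} \<in> edges G" "{z, x} \<in> edges G"
  shows "\<exists>C. (triangle C \<or> rectangle C) \<and> subgraph C G \<and> {x, y} \<in> edges C"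
proof (intro exI conjI)
  show "triangle (closed_path_graph [x, y, z]) \<or> rectangle (closed_path_graph [x, y, z])"
    unfolding triangle_def cycle_of_length_def using assms(2)
    by (intro disjI1 conjI exI[of _ "[x, y, z]"]) auto
  show "subgraph (closed_path_graph [x, y, z]) G"
    using assms unfolding subgraph_def verts_closed_path_graph edges_closed_path_graph_3 by auto
qed (simp add: edges_closed_path_graph_3)

lemma rectangleI:
  assumes "\<Union> (edges G) \<subseteq> verts G" and "distinct [w, x, y, z]"
    and "{w, x} \<in> edges G" "{x, y} \<in> edges G" "{y, z} \<in> edges G" "{z, w} \<in> edges G"
    and "e \<in> {{w, x}, {x, y}, {y, z}, {z, w}}"
  shows "\<exists>C. (triangle C \<or> rectangle C) \<and> subgraph C G \<and> e \<in> edges C"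
proof (intro exI conjI)
  show "triangle (closed_path_graph [w, x, y, z]) \<or> rectangle (closed_path_graph [w, x, y, z])"
    unfolding rectangle_def cycle_of_length_def using assms(2)
    by (intro disjI2 conjI exI[of _ "[w, x, y, z]"]) auto
  show "subgraph (closed_path_graph [w, x, y, z]) G"
    using assms unfolding subgraph_def verts_closed_path_graph edges_closed_path_graph_4 by auto
  show "e \<in> edges (closed_path_graph [w, x, y, z])"
    using assms(7) by (simp add: edges_closed_path_graph_4)
qed

text \<open>
  Going around the cycle periodically, positions that differ by one, two or three carry different
  vertices, because the length is at least four. In the cycle of length four itself the walk closes
  up, with \<open>d = b\<close> and \<open>a = c\<close>, so distinctness is claimed for four consecutive vertices at a time.
\<close>

lemma cycle_edge_walk:
  assumes "cycle_of_length k C" and "k \<ge> 4" and "e \<in> edges C"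
  obtains d a x y b c where "e = {x, y}"
    and "{d, a} \<in> edges C" "{a, x} \<in> edges C" "{x, y} \<in> edges C"
        "{y, b} \<in> edges C" "{b, c} \<in> edges C"
    and "distinct [d, a, x, y]" "distinct [a, x, y, b]" "distinct [x, y, b, c]"
proof -
  from assms(1) obtain xs where xs: "length xs = k" "distinct xs" "C = closed_path_graph xs"
    by (auto simp: cycle_of_length_def)
  from assms(3) obtain i where i: "i < k" "e = {xs ! i, xs ! ((i + 1) mod k)}"
    by (auto simp: xs closed_path_graph_def)
  \<comment> \<open>The walk starts two positions before \<open>i\<close>; adding \<open>k\<close> keeps the subtraction from truncating.\<close>
  define s where "s = i + k - 2"
  define p where "p j = xs ! ((s + j) mod k)" for j
  have edge: "{p j, p (Suc j)} \<in> edges C" for j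
  proof -
    have "(s + j) mod k < k" using assms(2) by simp
    moreover have "(s + Suc j) mod k = ((s + j) mod k + 1) mod k"
      by (simp add: mod_simps)
    ultimately show ?thesis
      by (auto simp: p_def xs closed_path_graph_def)
  qed
  have neq: "p j \<noteq> p l" if "j < l" "l \<le> j + 3" for j l
  proof
    assume "p j = p l"
    then have "(s + j) mod k = (s + l) mod k"
      using assms(2) xs by (simp add: p_def nth_eq_iff_index_eq)
    then have "k dvd (s + l) - (s + j)"
      using that(1) by (intro mod_eq_dvd_iff_nat[THEN iffD1]) auto
    then have "k \<le> l - j" using that(1) by (simp add: dvd_imp_le)
    with that(2) assms(2) show False by linarith
  qed
  have "s + 2 = i + k" "s + 3 = i + 1 + k"
    using assms(2) by (auto simp: s_def)
  then have "p 2 = xs ! i" "p 3 = xs ! ((i + 1) mod k)"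
    using i(1) by (simp_all only: p_def mod_add_self2 mod_less)
  with i have e: "e = {p 2, p 3}" by simp
  show thesis
  proof (rule that[OF e])
    show "{p 0, p 1} \<in> edges C" "{p 1, p 2} \<in> edges C" "{p 2, p 3} \<in> edges C"
      "{p 3, p 4} \<in> edges C" "{p 4, p 5} \<in> edges C"
      using edge[of 0] edge[of 1] edge[of 2] edge[of 3] edge[of 4]
      by (simp_all add: eval_nat_numeral)
    show "distinct [p 0, p 1, p 2, p 3]" "distinct [p 1, p 2, p 3, p 4]"
      "distinct [p 2, p 3, p 4, p 5]"
      by (simp_all add: neq)
  qed
qed

lemma edge_zd_graph_iff:
  "{x, y} \<in> edges (zd_graph X f) \<longleftrightarrow>
    x \<in> X \<and> y \<in> X \<and> x \<noteq> y \<and> f x \<noteq> 0 \<and> f y \<noteq> 0 \<and> f x * f y = 0"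
  by (auto simp: zd_graph_def doubleton_eq_iff mult.commute)

lemma edges_zd_graph_subset_verts:
  "\<Union> (edges (zd_graph X f)) \<subseteq> verts (zd_graph X f)"
  by (auto simp: zd_graph_def; metis mult.commute)

text \<open>
  A product \<open>f a * f b\<close> is annihilated by whatever annihilates one of its factors, so an element of
  \<open>X\<close> mapped to it inherits neighbours from both \<open>a\<close> and \<open>b\<close>. The outer vertices \<open>d\<close> and \<open>c\<close> of the
  walk serve for the degenerate cases in which this element is an endpoint of the edge \<open>x - y\<close>.
\<close>

lemma walk_middle_edge_in_short_cycle:
  fixes f :: "'x \<Rightarrow> 's::{ab_semigroup_mult, mult_zero}"
  assumes prod: "\<And>u v. u \<in> X \<Longrightarrow> v \<in> X \<Longrightarrow> f u * f v \<noteq> 0 \<Longrightarrow> \<exists>z\<in>X. f z = f u * f v"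
    and E: "{d, a} \<in> edges (zd_graph X f)" "{a, x} \<in> edges (zd_graph X f)"
      "{x, y} \<in> edges (zd_graph X f)" "{y, b} \<in> edges (zd_graph X f)"
      "{b, c} \<in> edges (zd_graph X f)"
    and D: "distinct [d, a, x, y]" "distinct [a, x, y, b]" "distinct [x, y, b, c]"
  shows "\<exists>C. (triangle C \<or> rectangle C) \<and> subgraph C (zd_graph X f) \<and> {x, y} \<in> edges C"
proof (cases "f a * f b = 0")
  case True
  then have "{b, a} \<in> edges (zd_graph X f)"
    using E D(2) by (auto simp: edge_zd_graph_iff mult.commute)
  then show ?thesis
    using E D by (intro rectangleI[OF edges_zd_graph_subset_verts, of a x y b]) auto
next
  case False
  have fact: "a \<in> X" "b \<in> X" "c \<in> X" "d \<in> X" "x \<in> X" "y \<in> X"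
    "f x \<noteq> 0" "f y \<noteq> 0" "f c \<noteq> 0" "f d \<noteq> 0"
    and ann: "f d * f a = 0" "f a * f x = 0" "f y * f b = 0" "f b * f c = 0"
    using E by (auto simp: edge_zd_graph_iff)
  obtain z where z: "z \<in> X" "f z = f a * f b"
    using prod[of a b] fact False by blast
  have zx: "f z * f x = 0"
    using ann(2) z(2) by (metis mult.assoc mult.commute mult_zero_left)
  have yz: "f y * f z = 0"
    using ann(3) z(2) by (metis mult.assoc mult.commute mult_zero_left)
  have cz: "f c * f z = 0"
    using ann(4) z(2) by (metis mult.assoc mult.commute mult_zero_left)
  have zd: "f z * f d = 0"
    using ann(1) z(2) by (metis mult.assoc mult.commute mult_zero_left)
  consider "z = x" | "z = y" | "z \<noteq> x" "z \<noteq> y" by blast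
  then show ?thesis
  proof cases
    case 1
    then have "{c, x} \<in> edges (zd_graph X f)"
      using cz fact D(3) by (auto simp: edge_zd_graph_iff)
    then show ?thesis
      using E D by (intro rectangleI[OF edges_zd_graph_subset_verts, of x y b c]) auto
  next
    case 2
    then have "{y, d} \<in> edges (zd_graph X f)"
      using zd fact D(1) by (auto simp: edge_zd_graph_iff)
    then show ?thesis
      using E D by (intro rectangleI[OF edges_zd_graph_subset_verts, of d a x y]) auto
  next
    case 3
    then have "{y, z} \<in> edges (zd_graph X f)" "{z, x} \<in> edges (zd_graph X f)"
      using yz zx fact z False by (auto simp: edge_zd_graph_iff)
    then show ?thesis
      using E D 3 by (intro triangleI[OF edges_zd_graph_subset_verts]) auto
  qed
qed

theorem theorem4p3:
  fixes X :: "'x set"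
    and f :: "'x \<Rightarrow> 's::{ab_semigroup_mult, mult_zero}"
  assumes "X \<noteq> {}"
    and "\<exists>T. T \<subseteq> verts (zd_graph X f) \<and> card T = 3"
    and "\<And>x y. x \<in> X \<Longrightarrow> y \<in> X \<Longrightarrow> f x * f y \<noteq> 0 \<Longrightarrow> \<exists>z\<in>X. f z = f x * f y"
    and "\<exists>C. is_cycle C \<and> subgraph C (zd_graph X f)"
  shows "\<exists>\<C>. (\<forall>C\<in>\<C>. triangle C \<or> rectangle C) \<and>
           core (zd_graph X f) = graph_Union \<C>"
proof -
  let ?G = "zd_graph X f"
  have "\<exists>C. (triangle C \<or> rectangle C) \<and> subgraph C ?G \<and> e \<in> edges C"
    if "e \<in> core_edges ?G" for e
  proof -
    from that obtain k C where C: "cycle_of_length k C" "subgraph C ?G" "e \<in> edges C"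
      by (auto simp: core_edges_def is_cycle_def)
    show ?thesis
    proof (cases "k = 3")
      case True
      with C show ?thesis by (auto simp: triangle_def)
    next
      case False
      with C(1) have "k \<ge> 4" by (simp add: cycle_of_length_def)
      from C(1) this C(3) show ?thesis
      proof (rule cycle_edge_walk)
        fix d a x y b c
        assume e: "e = {x, y}"
          and E: "{d, a} \<in> edges C" "{a, x} \<in> edges C" "{x, y} \<in> edges C"
            "{y, b} \<in> edges C" "{b, c} \<in> edges C"
          and D: "distinct [d, a, x, y]" "distinct [a, x, y, b]" "distinct [x, y, b, c]"
        have "edges C \<subseteq> edges ?G"
          using C(2) by (simp add: subgraph_def)
        from walk_middle_edge_in_short_cycle[OF assms(3) E[THEN subsetD[OF this]] D]
        show ?thesis unfolding e .
      qed
    qed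
  qed
  then show ?thesis
    by (intro exI[of _ "{C. (triangle C \<or> rectangle C) \<and> subgraph C ?G}"])
       (auto intro: core_eq_graph_Union)
qed

end
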